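(* Let $X$ be a compact metric space with metric $d$ and let $\phi:X\to X$ be a topologically exact continuous map. Let $\mathcal{S}=\{(\dots,x_{-1},x_0)\in X^{\mathbb{N}} : x_{-i}=\phi(x_{-i-1}) \text{ for all } i\ge 0\}$. Then: (i) For every $x_0\in X$ there exists a sequence $(\dots,x_{-2},x_{-1},x_0)\in\mathcal{S}$ with starting point $x_0$ such that the set $\{x_{-i}: i\ge 0\}$ is dense in $X$. (ii) For every $x_0,y_0\in X$ there exist sequences $(\dots,x_{-1},x_0)\in\mathcal{S}$ and $(\dots,y_{-1},y_0)\in\mathcal{S}$, with starting points $x_0$ and $y_0$ respectively, such that $\liminf_{i\to\infty} d(x_{-i},y_{-i})=0$.
   Context: A continuous map $\phi:X\to X$ is topologically exact if for every non-empty open set $W\subset X$ there is $j\in\mathbb{N}$ with $\phi^j(W)=X$. The set $\mathcal{S}$ is the inverse limit set of $\phi$; for $(\dots,x_{-1},x_0)\in\mathcal{S}$ the point $x_0$ is called the starting point. *)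

theory Defs
  imports "HOL-Analysis.Analysis"
begin

definition topologically_exact_on :: "'a::topological_space set \<Rightarrow> ('a \<Rightarrow> 'a) \<Rightarrow> bool" where
  "topologically_exact_on X \<phi> \<longleftrightarrow>
     (\<forall>W. openin (top_of_set X) W \<and> W \<noteq> {} \<longrightarrow> (\<exists>j::nat. (\<phi> ^^ j) ` W = X))"

(* A sequence (..., x_{-2}, x_{-1}, x_0) is encoded as a function on nat whose value at i is x_{-i};
   its starting point is the value at 0. *)
definition inverse_limit_set :: "'a set \<Rightarrow> ('a \<Rightarrow> 'a) \<Rightarrow> (nat \<Rightarrow> 'a) set" where
  "inverse_limit_set X \<phi> = {x. (\<forall>i. x i \<in> X) \<and> (\<forall>i. x i = \<phi> (x (Suc i)))}"

end

theory Submission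
  imports Defs
begin

text \<open>If \<open>W 0, W 1, \<dots>\<close> are non-empty open sets and \<open>\<phi>\<^bsup>j n\<^esup>\<close> maps \<open>W n\<close> onto \<open>X\<close>, then any
  point can be pulled back \<open>j 0\<close> steps into \<open>W 0\<close>, from there \<open>j 1\<close> steps into \<open>W 1\<close>, and so on. The
  visiting times \<open>j 0 + \<dots> + j n\<close> do not depend on the starting point. Taking for \<open>W\<close> a countable base
  gives dense backward orbits; taking balls shrinking to a point makes any two starting points have
  backward orbits that approach each other along the common visiting times.\<close>

text \<open>With two points present, delete one of them: some iterate maps the open remainder onto
  \<open>X\<close>, and it is not the zeroth, so \<open>\<phi>\<close> is its last factor. A space
  with at most one point is treated directly.\<close>

lemma topologically_exact_on_imp_surj:
  fixes X :: "'a::t1_space set"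
  assumes maps: "\<phi> \<in> X \<rightarrow> X" and exact: "topologically_exact_on X \<phi>"
  shows "\<phi> ` X = X"
proof (cases "\<exists>a. X \<subseteq> {a}")
  case True
  then obtain a where a: "X \<subseteq> {a}" by blast
  show ?thesis
  proof (cases "X = {}")
    case False
    with a have "X = {a}" by blast
    with maps show ?thesis by auto
  qed simp
next
  case False
  then obtain a b where ab: "a \<in> X" "b \<in> X" "a \<noteq> b" by blast
  have "openin (top_of_set X) (X - {a})"
    by (metis Diff_eq finite.emptyI finite_insert finite_imp_closed open_Compl openin_open_Int)
  with ab exact obtain j where j: "(\<phi> ^^ j) ` (X - {a}) = X"
    unfolding topologically_exact_on_def by blast
  \<comment> \<open>Exponent 0 would give \<open>X - {a} = X\<close>, although
    \<open>a \<in> X\<close>.\<close>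
  with ab obtain i where i: "j = Suc i"
    by (cases j) auto
  have "(\<phi> ^^ i) ` X \<subseteq> X"
    using maps by (induction i) auto
  then have "(\<phi> ^^ j) ` (X - {a}) \<subseteq> \<phi> ` X"
    unfolding i by auto
  with j maps show ?thesis by auto
qed

text \<open>By surjectivity one further application of \<open>\<phi>\<close> keeps the image equal
  to \<open>X\<close>. Positive exponents make the visiting times strictly increasing.\<close>

lemma topologically_exact_on_pos_iterate:
  fixes X :: "'a::t1_space set"
  assumes "\<phi> \<in> X \<rightarrow> X" and exact: "topologically_exact_on X \<phi>"
    and W: "openin (top_of_set X) W" "W \<noteq> {}"
  obtains j where "0 < j" "(\<phi> ^^ j) ` W = X"
proof -
  obtain j where j: "(\<phi> ^^ j) ` W = X"
    using exact W unfolding topologically_exact_on_def by blast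
  have "(\<phi> ^^ Suc j) ` W = \<phi> ` ((\<phi> ^^ j) ` W)"
    by (simp add: image_comp)
  also have "\<dots> = X"
    using j topologically_exact_on_imp_surj assms by metis
  finally show thesis
    using that[of "Suc j"] by blast
qed

text \<open>\<open>r\<close> is quantified before \<open>x0\<close>, so that two backward orbits can
  be compared at the same times.\<close>

lemma inverse_limit_visiting_open_sets:
  fixes X :: "'a::t1_space set"
  assumes maps: "\<phi> \<in> X \<rightarrow> X" and exact: "topologically_exact_on X \<phi>"
    and W: "\<And>n. openin (top_of_set X) (W n)" "\<And>n::nat. W n \<noteq> {}"
  shows "\<exists>r::nat \<Rightarrow> nat. strict_mono r \<and>
           (\<forall>x0\<in>X. \<exists>x\<in>inverse_limit_set X \<phi>. x 0 = x0 \<and> (\<forall>n. x (r n) \<in> W n))"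
proof -
  have "\<exists>j. 0 < j \<and> (\<phi> ^^ j) ` W n = X" for n
    using topologically_exact_on_pos_iterate[OF maps exact W(1)[of n] W(2)[of n]] by blast
  then obtain j where j: "\<And>n. 0 < j n" "\<And>n. (\<phi> ^^ j n) ` W n = X"
    by metis
  define k where "k n = sum j {..<n}" for n
  have k_simps: "k 0 = 0" "k (Suc n) = k n + j n" for n
    by (simp_all add: k_def)
  have "strict_mono k"
    using j(1) by (simp add: strict_mono_Suc_iff k_simps)
  then have k_ge: "n \<le> k n" for n
    by (rule strict_mono_imp_increasing)
  have WX: "W n \<subseteq> X" for n
    using W(1) openin_imp_subset by blast
  have "\<exists>x\<in>inverse_limit_set X \<phi>. x 0 = x0 \<and> (\<forall>n. x (k (Suc n)) \<in> W n)" if x0: "x0 \<in> X" for x0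
  proof -
    have step: "\<exists>w. w \<in> W n \<and> (\<phi> ^^ j n) w = z" if "z \<in> X" for n z
      using that j(2)[of n] by blast
    \<comment> \<open>The point \<open>z n\<close> is to become the entry of the orbit at time
      \<open>k n\<close>; the visit to \<open>W n\<close> thus happens at
      \<open>k (Suc n)\<close>.\<close>
    have "\<exists>z. \<forall>n. (z n \<in> X \<and> (n = 0 \<longrightarrow> z n = x0)) \<and>
              (z (Suc n) \<in> W n \<and> (\<phi> ^^ j n) (z (Suc n)) = z n)"
      by (rule dependent_nat_choice) (use x0 step WX in blast)+
    then obtain z where z: "\<And>n. z n \<in> X" "z 0 = x0" "\<And>n. z (Suc n) \<in> W n"
      "\<And>n. (\<phi> ^^ j n) (z (Suc n)) = z n"
      by metis
    have funpow_z: "(\<phi> ^^ (k (n + d) - k n)) (z (n + d)) = z n" for n d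
    proof (induction d)
      case (Suc d)
      have "k n \<le> k (n + d)"
        using \<open>strict_mono k\<close> by (simp add: strict_mono_less_eq)
      then have "k (n + Suc d) - k n = (k (n + d) - k n) + j (n + d)"
        by (simp add: k_simps)
      then show ?case
        using Suc z(4)[of "n + d"] by (simp add: funpow_add)
    qed simp
    \<comment> \<open>Since \<open>i \<le> k i\<close>, the entry at time \<open>i\<close> is
      reached from \<open>z i\<close> by going forward \<open>k i - i\<close> steps. This avoids
      searching for the block of times that contains \<open>i\<close>.\<close>
    define x where "x i = (\<phi> ^^ (k i - i)) (z i)" for i
    have "(\<phi> ^^ m) ` X \<subseteq> X" for m
      using maps by (induction m) auto
    then have "x i \<in> X" for i
      using z(1) unfolding x_def by blast
    moreover have "x i = \<phi> (x (Suc i))" for i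
    proof -
      have "\<phi> (x (Suc i)) = (\<phi> ^^ Suc (k (Suc i) - Suc i)) (z (Suc i))"
        by (simp add: x_def)
      \<comment> \<open>The truncated subtractions are exact because \<open>i \<le> k i\<close> and
        \<open>Suc i \<le> k (Suc i)\<close>.\<close>
      also have "Suc (k (Suc i) - Suc i) = (k i - i) + j i"
        using k_ge[of i] k_ge[of "Suc i"] by (simp add: k_simps)
      finally show ?thesis
        using z(4)[of i] by (simp add: funpow_add x_def)
    qed
    ultimately have "x \<in> inverse_limit_set X \<phi>"
      unfolding inverse_limit_set_def by blast
    moreover have "x 0 = x0"
      by (simp add: x_def k_simps z)
    \<comment> \<open>By definition \<open>x (k n)\<close> is an iterate of \<open>z (k n)\<close>,
      so \<open>d\<close> is chosen to make \<open>n + d = k n\<close>.\<close>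
    moreover have "x (k n) = z n" for n
      using funpow_z[of n "k n - n"] k_ge[of n] by (simp add: x_def)
    ultimately show ?thesis
      using z(3) by metis
  qed
  moreover have "strict_mono (\<lambda>n. k (Suc n))"
    using \<open>strict_mono k\<close> by (simp add: strict_mono_def)
  ultimately show ?thesis by blast
qed

text \<open>Compactness gives for each \<open>n\<close> a finite cover by balls of radius
  \<open>1/(n+1)\<close> with centres in \<open>X\<close>; all these balls together form the family.
  \<open>W n\<close> need not contain \<open>a\<close>: meeting every ball is enough for
  density.\<close>

lemma compact_imp_countable_pseudobase:
  fixes X :: "'a::metric_space set"
  assumes "compact X" "X \<noteq> {}"
  shows "\<exists>W::nat \<Rightarrow> 'a set. (\<forall>n. openin (top_of_set X) (W n) \<and> W n \<noteq> {}) \<and>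
           (\<forall>a\<in>X. \<forall>e>0. \<exists>n. W n \<subseteq> ball a e)"
proof -
  have "\<exists>K. finite K \<and> K \<subseteq> X \<and> X \<subseteq> (\<Union>c\<in>K. ball c (inverse (Suc n)))" for n
  proof (rule compactE_image[OF assms(1)])
    show "X \<subseteq> (\<Union>c\<in>X. ball c (inverse (Suc n)))" by auto
  qed blast+
  then obtain K where K: "\<And>n. finite (K n)" "\<And>n. K n \<subseteq> X"
    "\<And>n::nat. X \<subseteq> (\<Union>c\<in>K n. ball c (inverse (Suc n)))"
    by metis
  define B where "B = (\<Union>n. (\<lambda>c. X \<inter> ball c (inverse (Suc n))) ` K n)"
  have "K 0 \<noteq> {}"
    using K(3)[of 0] assms(2) by auto
  then have "B \<noteq> {}"
    by (auto simp: B_def)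
  moreover have "countable B"
    using K(1) by (auto simp: B_def countable_finite)
  ultimately have range_B: "range (from_nat_into B) = B"
    by (rule range_from_nat_into)
  have B: "openin (top_of_set X) V" "V \<noteq> {}" if V: "V \<in> B" for V
  proof -
    obtain n c where "c \<in> K n" and V_eq: "V = X \<inter> ball c (inverse (Suc n))"
      using V by (auto simp: B_def)
    then have "c \<in> V"
      using K(2)[of n] by auto
    then show "V \<noteq> {}" by blast
    show "openin (top_of_set X) V"
      unfolding V_eq by (intro openin_open_Int open_ball)
  qed
  have small: "\<exists>V\<in>B. V \<subseteq> ball a e" if ae: "a \<in> X" "0 < e" for a e
  proof -
    \<comment> \<open>Half of \<open>e\<close> bounds the distance from \<open>a\<close> to the
      centre \<open>c\<close>, the other half the radius of the ball around
      \<open>c\<close>.\<close>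
    obtain n where n: "inverse (Suc n) < e / 2"
      using reals_Archimedean[of "e / 2"] ae(2) by auto
    obtain c where c: "c \<in> K n" "dist c a < inverse (Suc n)"
      using K(3)[of n] ae(1) by auto
    have "ball c (inverse (Suc n)) \<subseteq> ball a e"
    proof
      fix p assume "p \<in> ball c (inverse (Suc n))"
      then show "p \<in> ball a e"
        using c(2) n dist_triangle[of a p c] by (simp add: dist_commute)
    qed
    then show ?thesis
      using c(1) unfolding B_def by blast
  qed
  have "from_nat_into B n \<in> B" for n
    using range_B by blast
  then have "\<forall>n. openin (top_of_set X) (from_nat_into B n) \<and> from_nat_into B n \<noteq> {}"
    using B by blast
  moreover have "\<forall>a\<in>X. \<forall>e>0. \<exists>n. from_nat_into B n \<subseteq> ball a e"
    using small range_B by (metis imageE)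
  ultimately show ?thesis by blast
qed

theorem theorem2:
  fixes X :: "'a::metric_space set" and \<phi> :: "'a \<Rightarrow> 'a"
  assumes "compact X"
    and "\<phi> \<in> X \<rightarrow> X"
    and "continuous_on X \<phi>"
    and "topologically_exact_on X \<phi>"
  shows "(\<forall>x0\<in>X. \<exists>x\<in>inverse_limit_set X \<phi>.
            x 0 = x0 \<and> top_of_set X closure_of range x = X) \<and>
         (\<forall>x0\<in>X. \<forall>y0\<in>X. \<exists>x\<in>inverse_limit_set X \<phi>. \<exists>y\<in>inverse_limit_set X \<phi>.
            x 0 = x0 \<and> y 0 = y0 \<and> liminf (\<lambda>i. ereal (dist (x i) (y i))) = 0)"
proof (intro conjI ballI)
  fix x0 assume x0: "x0 \<in> X"
  then have "X \<noteq> {}" by blast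
  from compact_imp_countable_pseudobase[OF assms(1) this]
  obtain W where W: "\<And>n::nat. openin (top_of_set X) (W n)" "\<And>n. W n \<noteq> {}"
    and small: "\<And>a e. a \<in> X \<Longrightarrow> 0 < e \<Longrightarrow> \<exists>n. W n \<subseteq> ball a e"
    by blast
  obtain r :: "nat \<Rightarrow> nat" where
    "\<And>x0. x0 \<in> X \<Longrightarrow> \<exists>x\<in>inverse_limit_set X \<phi>. x 0 = x0 \<and> (\<forall>n. x (r n) \<in> W n)"
    using inverse_limit_visiting_open_sets[of \<phi> X W, OF assms(2,4) W] by blast
  with x0 obtain x where x: "x \<in> inverse_limit_set X \<phi>" "x 0 = x0" "\<And>n. x (r n) \<in> W n"
    by blast
  have "X \<subseteq> closure (range x)"
  proof
    fix a assume "a \<in> X"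
    have "\<exists>p\<in>range x. dist p a < e" if "0 < e" for e
    proof -
      obtain n where "W n \<subseteq> ball a e"
        using small \<open>a \<in> X\<close> \<open>0 < e\<close> by blast
      then have "dist (x (r n)) a < e"
        using x(3)[of n] by (auto simp: dist_commute)
      then show ?thesis by blast
    qed
    then show "a \<in> closure (range x)"
      by (simp add: closure_approachable)
  qed
  moreover have "range x \<subseteq> X"
    using x(1) unfolding inverse_limit_set_def by blast
  ultimately have "top_of_set X closure_of range x = X"
    by (auto simp: closure_of_subtopology Int_absorb1)
  with x show "\<exists>x\<in>inverse_limit_set X \<phi>. x 0 = x0 \<and> top_of_set X closure_of range x = X"
    by blast
next
  fix x0 y0 assume x0: "x0 \<in> X" and y0: "y0 \<in> X"
  \<comment> \<open>Both orbits are steered towards the same point \<open>x0\<close>, so their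
    distance tends to 0 along \<open>r\<close>.\<close>
  define W where "W n = X \<inter> ball x0 (inverse (Suc n))" for n
  have "openin (top_of_set X) (W n)" for n
    unfolding W_def by (intro openin_open_Int open_ball)
  moreover have "W n \<noteq> {}" for n
    using x0 by (auto simp: W_def)
  ultimately
  obtain r where r: "strict_mono r"
    "\<And>x0. x0 \<in> X \<Longrightarrow> \<exists>x\<in>inverse_limit_set X \<phi>. x 0 = x0 \<and> (\<forall>n. x (r n) \<in> W n)"
    using inverse_limit_visiting_open_sets[OF assms(2,4), of W] by blast
  obtain x where x: "x \<in> inverse_limit_set X \<phi>" "x 0 = x0" "\<And>n. x (r n) \<in> W n"
    using r(2)[OF x0] by blast
  obtain y where y: "y \<in> inverse_limit_set X \<phi>" "y 0 = y0" "\<And>n. y (r n) \<in> W n"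
    using r(2)[OF y0] by blast
  define D where "D i = ereal (dist (x i) (y i))" for i
  have lim_x: "(\<lambda>n. x (r n)) \<longlonglongrightarrow> x0" and lim_y: "(\<lambda>n. y (r n)) \<longlonglongrightarrow> x0"
    using x(3) y(3)
    by (auto simp: W_def dist_commute less_imp_le
        intro!: metric_tendsto_imp_tendsto[OF LIMSEQ_inverse_real_of_nat])
  have "(\<lambda>n. dist (x (r n)) (y (r n))) \<longlonglongrightarrow> 0"
    using tendsto_dist[OF lim_x lim_y] by simp
  then have "(D \<circ> r) \<longlonglongrightarrow> 0"
    by (simp add: D_def o_def zero_ereal_def)
  then have "liminf (D \<circ> r) = 0"
    by (simp add: lim_imp_Liminf)
  \<comment> \<open>Passing to a subsequence can only raise the liminf, so this gives the upper
    bound; the lower one comes from distances being nonnegative.\<close>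
  then have "liminf D \<le> 0"
    using liminf_subseq_mono[OF r(1), of D] by simp
  moreover have "0 \<le> liminf D"
    by (intro Liminf_bounded) (simp add: D_def)
  ultimately have "liminf D = 0" by simp
  with x y show "\<exists>x\<in>inverse_limit_set X \<phi>. \<exists>y\<in>inverse_limit_set X \<phi>.
      x 0 = x0 \<and> y 0 = y0 \<and> liminf (\<lambda>i. ereal (dist (x i) (y i))) = 0"
    unfolding D_def by blast
qed

end
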